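(* Let $\mathcal{H}$ be a $k$-uniform hypergraph with $n$ vertices and $m$ edges, and let $s\ge1$ and $r>ks$ be integers. Then: (a) if $r-ks>d(\mathcal{H}^r_s)$, then $\mathtt{QE}(\mathcal{H}^r_s)=2rm\left(1-\frac{m}{ns+(r-ks)m}\right)>2ksm$; (b) if $r-ks=d(\mathcal{H}^r_s)$, then $\mathtt{QE}(\mathcal{H}^r_s)=2ksm$; (c) if $r-ks<d(\mathcal{H}^r_s)$, then $\mathtt{QE}(\mathcal{H}^r_s)<2ksm$.
   Context: A hypergraph $\mathcal{H}=(V,E)$ is $k$-uniform ($k\ge2$) if every edge has exactly $k$ vertices. For integers $s\ge1$, $r\ge ks$, the power hypergraph $\mathcal{H}^r_s$ is the $r$-uniform hypergraph obtained by replacing each vertex $v\in V$ by a set $\varsigma_v$ of $s$ new vertices and adding to each edge $e\in E$ a set $\varsigma_e$ of $r-ks$ new vertices (all these sets pairwise disjoint): its vertex set is $\bigcup_{v}\varsigma_v\cup\bigcup_e\varsigma_e$ (so it has $ns+(r-ks)m$ vertices) and its edges are $\varsigma_e\cup\varsigma_{v_1}\cup\cdots\cup\varsigma_{v_k}$ for each $e=\{v_1,\dots,v_k\}\in E$. For a uniform hypergraph $\mathcal{G}$ with $N$ vertices, $M$ edges, each of size $q$, the incidence matrix $\mathbf{B}$ is the $N\times M$ 0/1 vertex-edge incidence matrix, the signless Laplacian is $\mathbf{Q}=\mathbf{B}\mathbf{B}^T$, the average degree is $d(\mathcal{G})=qM/N$, and the signless Laplacian energy is $\mathtt{QE}(\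mathcal{G})=\sum_{i=1}^N|\lambda_i(\mathbf{Q})-d(\mathcal{G})|$.
   Formalization: The strict inequality "> 2ksm" in (a) is stated only for m ≥ 1, since for a hypergraph without edges (m = 0) both sides equal 0 and it fails; the equality in (a) and parts (b), (c) are stated without this restriction. *)

theory Defs
  imports "Jordan_Normal_Form.Char_Poly" "HOL-Computational_Algebra.Polynomial"
begin

type_synonym 'a hypergraph = "'a set \<times> 'a set set"

abbreviation hverts :: "'a hypergraph \<Rightarrow> 'a set" where
  "hverts H \<equiv> fst H"

abbreviation hedges :: "'a hypergraph \<Rightarrow> 'a set set" where
  "hedges H \<equiv> snd H"

definition uniform_hypergraph :: "nat \<Rightarrow> 'a hypergraph \<Rightarrow> bool" where
  "uniform_hypergraph k H \<longleftrightarrow>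
     finite (hverts H) \<and> (\<forall>e\<in>hedges H. e \<subseteq> hverts H \<and> card e = k)"

datatype 'a power_vertex = VertexCopy 'a nat | EdgeCopy "'a set" nat

definition vertex_copies :: "nat \<Rightarrow> 'a \<Rightarrow> 'a power_vertex set" where
  "vertex_copies s v = VertexCopy v ` {..<s}"

definition edge_copies :: "nat \<Rightarrow> 'a set \<Rightarrow> 'a power_vertex set" where
  "edge_copies t e = EdgeCopy e ` {..<t}"

text \<open>The power hypergraph of a \<open>k\<close>-uniform hypergraph; only meaningful for \<open>r \<ge> k * s\<close>
  (otherwise the subtraction truncates).\<close>

definition power_hypergraph ::
    "nat \<Rightarrow> nat \<Rightarrow> nat \<Rightarrow> 'a hypergraph \<Rightarrow> 'a power_vertex hypergraph" where
  "power_hypergraph k r s H =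
     ((\<Union>v\<in>hverts H. vertex_copies s v) \<union> (\<Union>e\<in>hedges H. edge_copies (r - k * s) e),
      (\<lambda>e. edge_copies (r - k * s) e \<union> (\<Union>v\<in>e. vertex_copies s v)) ` hedges H)"

definition enumeration :: "'a set \<Rightarrow> 'a list" where
  "enumeration A = (SOME xs. distinct xs \<and> set xs = A)"

text \<open>Rows and columns follow an arbitrary but fixed enumeration of the vertices and of the edges.
  Another enumeration conjugates the signless Laplacian by a permutation matrix, so its spectrum
  does not depend on the choice.\<close>

definition incidence_matrix :: "'a hypergraph \<Rightarrow> real mat" where
  "incidence_matrix H =
     mat (card (hverts H)) (card (hedges H))
       (\<lambda>(i, j). if enumeration (hverts H) ! i \<in> enumeration (hedges H) ! j then 1 else 0)"

definition signless_laplacian :: "'a hypergraph \<Rightarrow> real mat" where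
  "signless_laplacian H = incidence_matrix H * transpose_mat (incidence_matrix H)"

text \<open>The argument \<open>q\<close> is the common size of the edges.\<close>

definition average_degree :: "nat \<Rightarrow> 'a hypergraph \<Rightarrow> real" where
  "average_degree q H = real q * real (card (hedges H)) / real (card (hverts H))"

text \<open>The signless Laplacian is real symmetric, so its characteristic polynomial splits over the
  reals and the multiset of its real roots consists of all eigenvalues with multiplicity.\<close>

definition signless_laplacian_energy :: "nat \<Rightarrow> 'a hypergraph \<Rightarrow> real" where
  "signless_laplacian_energy q H =
     (\<Sum>x\<in>#proots (char_poly (signless_laplacian H)). \<bar>x - average_degree q H\<bar>)"

end

theory Submission
  imports Defs "Jordan_Normal_Form.Schur_Decomposition"
begin

text \<open>Let \<open>B\<close> be the incidence matrix of the power hypergraph, \<open>N\<close> its number of vertices,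
  \<open>d\<close> its average degree and \<open>t = r - ks\<close>. The spectrum of \<open>B B\<^sup>T\<close> is that of the Gram
  matrix \<open>B\<^sup>T B\<close> together with \<open>N - m\<close> zeros. Every edge has \<open>t\<close> vertices that lie in no other
  edge, and at such a vertex \<open>B w\<close> takes the value \<open>w\<^sub>e\<close>; hence \<open>\<bar>B w\<bar>\<^sup>2 \<ge> t \<bar>w\<bar>\<^sup>2\<close>
  and all eigenvalues of the Gram matrix are at least \<open>t\<close>. Their sum is the trace \<open>r m\<close>.
  If \<open>t \<ge> d\<close>, the absolute values in the energy can be dropped, which gives \<open>2m(r - d)\<close>.
  If \<open>t < d\<close>, each eigenvalue satisfies \<open>\<bar>a - d\<bar> \<le> a + d - 2t\<close>, with strict inequality for
  some \<open>a\<close> since the mean \<open>r\<close> exceeds \<open>t\<close>.\<close>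

section \<open>Characteristic polynomials of \<open>A * B\<close> and \<open>B * A\<close>\<close>

text \<open>The characteristic matrix of a block lower triangular matrix is again block lower
  triangular, so its determinant over the polynomial ring factors along the diagonal blocks.\<close>

lemma char_poly_block_upper_right_zero:
  fixes B :: "'a :: idom mat"
  assumes "B \<in> carrier_mat n n" "C \<in> carrier_mat m n" "D \<in> carrier_mat m m"
  shows "char_poly (four_block_mat B (0\<^sub>m n m) C D) = char_poly B * char_poly D"
proof -
  let ?cm = "\<lambda>A. [:0, 1:] \<cdot>\<^sub>m 1\<^sub>m (dim_row A) + map_mat (\<lambda>a. [:- a:]) A"
  have "?cm (four_block_mat B (0\<^sub>m n m) C D) =
      four_block_mat (?cm B) (0\<^sub>m n m) (map_mat (\<lambda>a. [:- a:]) C) (?cm D)"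
    by (rule eq_matI) (use assms in auto)
  then show ?thesis
    unfolding char_poly_defs
    using det_four_block_mat_upper_right_zero[of "?cm B" n "0\<^sub>m n m" m "map_mat (\<lambda>a. [:- a:]) C" "?cm D"]
      assms by simp
qed

lemma char_poly_zero_mat: "char_poly (0\<^sub>m n n :: 'a :: comm_ring_1 mat) = [:0, 1:] ^ n"
proof -
  have "diag_mat (0\<^sub>m n n :: 'a mat) = replicate n 0"
    by (rule nth_equalityI) (auto simp: diag_mat_def)
  then show ?thesis
    by (subst char_poly_upper_triangular[of _ n]) (auto simp: prod_list_replicate)
qed

text \<open>The block matrices with rows \<open>AB, 0\<close> and \<open>B, 0\<close>, respectively \<open>0, 0\<close> and \<open>B, BA\<close>,
  are conjugate by the unitriangular block matrix with upper right block \<open>A\<close>.\<close>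

lemma char_poly_mult_swap:
  fixes A B :: "'a :: idom mat"
  assumes A: "A \<in> carrier_mat n m" and B: "B \<in> carrier_mat m n"
  shows "[:0, 1:] ^ m * char_poly (A * B) = [:0, 1:] ^ n * char_poly (B * A)"
proof -
  define X where "X = four_block_mat (A * B) (0\<^sub>m n m) B (0\<^sub>m m m)"
  define Y where "Y = four_block_mat (0\<^sub>m n n) (0\<^sub>m n m) B (B * A)"
  define P where "P = four_block_mat (1\<^sub>m n) A (0\<^sub>m m n) (1\<^sub>m m)"
  define Q where "Q = four_block_mat (1\<^sub>m n) (- A) (0\<^sub>m m n) (1\<^sub>m m)"
  have mA: "- A \<in> carrier_mat n m" using A by simp
  have AB: "A * B \<in> carrier_mat n n" and BA: "B * A \<in> carrier_mat m m" using A B by auto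
  have sum0: "A + - A = 0\<^sub>m n m" "- A + A = 0\<^sub>m n m"
    using A by auto
  have neg0: "- 0\<^sub>m m m = (0\<^sub>m m m :: 'a mat)" by auto
  have PQ: "P * Q = 1\<^sub>m (n + m)"
    unfolding P_def Q_def
    by (subst mult_four_block_mat[OF one_carrier_mat A zero_carrier_mat one_carrier_mat
          one_carrier_mat mA zero_carrier_mat one_carrier_mat]) (use A mA sum0 neg0 in simp)
  have QP: "Q * P = 1\<^sub>m (n + m)"
    unfolding P_def Q_def
    by (subst mult_four_block_mat[OF one_carrier_mat mA zero_carrier_mat one_carrier_mat
          one_carrier_mat A zero_carrier_mat one_carrier_mat]) (use A mA sum0 neg0 in simp)
  \<comment> \<open>\<open>P * Y\<close> and \<open>X * P\<close> multiply out to the same block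
    matrix, and \<open>Q\<close> inverts \<open>P\<close>; this yields the conjugacy.\<close>
  have PY: "P * Y = four_block_mat (A * B) (A * (B * A)) B (B * A)"
    unfolding P_def Y_def
    by (subst mult_four_block_mat[OF one_carrier_mat A zero_carrier_mat one_carrier_mat
          zero_carrier_mat zero_carrier_mat B BA]) (use A B AB BA in simp)
  have XP: "X * P = four_block_mat (A * B) (A * (B * A)) B (B * A)"
    unfolding P_def X_def
    by (subst mult_four_block_mat[OF AB zero_carrier_mat B zero_carrier_mat
          one_carrier_mat A zero_carrier_mat one_carrier_mat]) (use A B AB BA in simp)
  have carr: "{X, Y, P, Q} \<subseteq> carrier_mat (n + m) (n + m)"
    using A B by (auto simp: X_def Y_def P_def Q_def)
  have "P * Y * Q = X * P * Q" using PY XP by simp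
  also have "\<dots> = X * (P * Q)"
    by (rule assoc_mult_mat) (use carr in auto)
  also have "\<dots> = X" using PQ carr right_mult_one_mat[of X "n + m" "n + m"] by simp
  finally have "similar_mat X Y"
    by (intro similar_matI[OF carr PQ QP]) simp
  then have "char_poly X = char_poly Y" by (rule char_poly_similar)
  moreover have "char_poly X = char_poly (A * B) * [:0, 1:] ^ m"
    unfolding X_def using char_poly_block_upper_right_zero[OF AB B, of "0\<^sub>m m m"]
    by (simp add: char_poly_zero_mat)
  moreover have "char_poly Y = [:0, 1:] ^ n * char_poly (B * A)"
    unfolding Y_def using char_poly_block_upper_right_zero[of "0\<^sub>m n n" n B m "B * A"] B BA
    by (simp add: char_poly_zero_mat)
  ultimately show ?thesis by (simp add: mult.commute)
qed

section \<open>Trace and real spectrum of symmetric matrices\<close>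

lemma diag_sum_mult_swap:
  fixes A B :: "'a :: comm_semiring_0 mat"
  assumes "A \<in> carrier_mat n m" "B \<in> carrier_mat m n"
  shows "(\<Sum>i<n. (A * B) $$ (i, i)) = (\<Sum>j<m. (B * A) $$ (j, j))"
proof -
  have "(\<Sum>i<n. (A * B) $$ (i, i)) = (\<Sum>i<n. \<Sum>j<m. A $$ (i, j) * B $$ (j, i))"
    using assms by (auto simp: scalar_prod_def lessThan_atLeast0)
  also have "\<dots> = (\<Sum>j<m. \<Sum>i<n. A $$ (i, j) * B $$ (j, i))"
    by (rule sum.swap)
  also have "\<dots> = (\<Sum>j<m. (B * A) $$ (j, j))"
    using assms by (auto simp: scalar_prod_def lessThan_atLeast0 mult.commute)
  finally show ?thesis .
qed

text \<open>Schur decomposition makes \<open>A\<close> similar to a triangular matrix with diagonal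
  \<open>as\<close>, and similar matrices have equal trace.\<close>

lemma sum_list_roots_char_poly:
  fixes A :: "'a :: conjugatable_ordered_field mat"
  assumes A: "A \<in> carrier_mat n n" and cp: "char_poly A = (\<Prod>a\<leftarrow>as. [:- a, 1:])"
  shows "sum_list as = (\<Sum>i<n. A $$ (i, i))"
proof -
  obtain T P Q where "schur_decomposition A as = (T, P, Q)"
    by (cases "schur_decomposition A as") auto
  from schur_decomposition[OF A cp this] have sim: "similar_mat_wit A T P Q" and diag: "diag_mat T = as"
    by auto
  from similar_mat_witD2[OF A sim] have
    QP: "Q * P = 1\<^sub>m n" and A_eq: "A = P * T * Q"
    and T: "T \<in> carrier_mat n n" and P: "P \<in> carrier_mat n n" and Q: "Q \<in> carrier_mat n n"
    by auto
  have "(\<Sum>i<n. A $$ (i, i)) = (\<Sum>i<n. (P * (T * Q)) $$ (i, i))"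
    using A_eq assoc_mult_mat[OF P T Q] by simp
  also have "\<dots> = (\<Sum>i<n. (T * Q * P) $$ (i, i))"
    using diag_sum_mult_swap[of P n n "T * Q"] P T Q by simp
  also have "T * Q * P = T"
    using assoc_mult_mat[OF T Q P] QP T by simp
  also have "(\<Sum>i<n. T $$ (i, i)) = sum_list (diag_mat T)"
    using T by (simp add: diag_mat_def sum_list_sum_nth lessThan_atLeast0)
  finally show ?thesis using diag by simp
qed

text \<open>Since \<open>A\<close> is real, \<open>conjugate v\<close> is an eigenvector for
  \<open>cnj z\<close>. Moving the symmetric matrix across the product of \<open>conjugate v\<close>
  and \<open>v\<close> gives \<open>cnj z = z\<close> after cancelling the nonzero squared norm of
  \<open>v\<close>.\<close>

lemma eigenvalue_symmetric_real:
  fixes A :: "real mat"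
  assumes A: "A \<in> carrier_mat n n" and sym: "transpose_mat A = A"
    and ev: "eigenvalue (map_mat complex_of_real A) z"
  shows "z \<in> \<real>"
proof -
  let ?A = "map_mat complex_of_real A"
  from ev A obtain v where v: "v \<in> carrier_vec n" "v \<noteq> 0\<^sub>v n" "?A *\<^sub>v v = z \<cdot>\<^sub>v v"
    by (auto simp: eigenvalue_def eigenvector_def)
  have cv: "conjugate v \<in> carrier_vec n" using v by simp
  have "?A *\<^sub>v conjugate v = conjugate (?A *\<^sub>v v)"
    by (rule eq_vecI) (use A v(1) in \<open>auto simp: scalar_prod_def\<close>)
  also have "\<dots> = cnj z \<cdot>\<^sub>v conjugate v"
    unfolding v(3) by (rule eq_vecI) (use v in auto)
  finally have Acv: "?A *\<^sub>v conjugate v = cnj z \<cdot>\<^sub>v conjugate v" .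
  have "transpose_mat ?A = ?A"
    using arg_cong[OF sym, of "map_mat complex_of_real"] by (simp add: map_mat_transpose)
  then have "(?A *\<^sub>v conjugate v) \<bullet> v = conjugate v \<bullet> (?A *\<^sub>v v)"
    using transpose_vec_mult_scalar[of ?A n n v "conjugate v"] A v cv by simp
  then have "cnj z * (conjugate v \<bullet> v) = z * (conjugate v \<bullet> v)"
    using v cv unfolding Acv v(3) by simp
  moreover have "conjugate v \<bullet> v \<noteq> 0"
    using v cv conjugate_square_eq_0_vec[of v n] comm_scalar_prod[of v n "conjugate v"] by auto
  ultimately show ?thesis by (simp add: Reals_cnj_iff)
qed

text \<open>The complex factorization has only real roots, so it is the image of a real one;
  injectivity of the embedding of polynomials carries it back.\<close>

lemma char_poly_symmetric_splits:
  fixes A :: "real mat"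
  assumes A: "A \<in> carrier_mat n n" and sym: "transpose_mat A = A"
  obtains as where "char_poly A = (\<Prod>a\<leftarrow>as. [:- a, 1:])" "length as = n"
proof -
  interpret poly: map_poly_inj_idom_hom complex_of_real ..
  let ?A = "map_mat complex_of_real A"
  have cA: "?A \<in> carrier_mat n n" using A by simp
  obtain bs where bs: "char_poly ?A = (\<Prod>b\<leftarrow>bs. [:- b, 1:])" "length bs = n"
    using char_poly_factorized[OF cA] by blast
  have real: "complex_of_real (Re b) = b" if "b \<in> set bs" for b
  proof -
    have "poly (char_poly ?A) b = 0"
      unfolding bs(1) using that by (auto simp: poly_prod_list prod_list_zero_iff)
    then have "b \<in> \<real>"
      using eigenvalue_symmetric_real[OF A sym] eigenvalue_root_char_poly[OF cA] by blast
    then show ?thesis by simp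
  qed
  have "map_poly complex_of_real (char_poly A) = char_poly ?A"
    by (rule of_real_hom.char_poly_hom[OF A, symmetric])
  also have "\<dots> = (\<Prod>b\<leftarrow>bs. map_poly complex_of_real [:- Re b, 1:])"
    unfolding bs(1) using real by (intro arg_cong[of _ _ prod_list] map_cong) auto
  also have "\<dots> = map_poly complex_of_real (\<Prod>a\<leftarrow>map Re bs. [:- a, 1:])"
    by (simp add: poly.hom_prod_list o_def)
  finally have "char_poly A = (\<Prod>a\<leftarrow>map Re bs. [:- a, 1:])"
    by (rule poly.injectivity)
  then show thesis using that[of "map Re bs"] bs(2) by simp
qed

section \<open>Spectrum of \<open>B * transpose_mat B\<close>\<close>

lemma proots_prod_linear_factors:
  fixes as :: "'a :: idom list"
  shows "proots (\<Prod>a\<leftarrow>as. [:- a, 1:]) = mset as"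
proof (induction as)
  case (Cons a as)
  have "(\<Prod>a\<leftarrow>as. [:- a, 1:]) \<noteq> 0" by (auto simp: prod_list_zero_iff)
  then have "proots ([:- a, 1:] * (\<Prod>a\<leftarrow>as. [:- a, 1:])) = mset (a # as)"
    by (subst proots_mult) (auto simp: Cons.IH)
  then show ?case by (simp only: list.map prod_list.Cons)
qed simp

text \<open>The \<open>as\<close> are the eigenvalues of the Gram matrix
  \<open>transpose_mat B * B\<close>: \<open>bound\<close> says that its Rayleigh quotient is at
  least \<open>c\<close>, and the sum of the squared entries of \<open>B\<close> is its
  trace.\<close>

theorem proots_char_poly_mult_transpose:
  fixes B :: "real mat" and c :: real
  assumes B: "B \<in> carrier_mat N M" and "M \<le> N"
    and bound: "\<And>w. w \<in> carrier_vec M \<Longrightarrow> c * (w \<bullet> w) \<le> (B *\<^sub>v w) \<bullet> (B *\<^sub>v w)"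
  obtains as where "proots (char_poly (B * transpose_mat B)) = replicate_mset (N - M) 0 + mset as"
    "length as = M" "\<And>a. a \<in> set as \<Longrightarrow> c \<le> a"
    "sum_list as = (\<Sum>j<M. \<Sum>i<N. (B $$ (i, j))\<^sup>2)"
proof -
  let ?G = "transpose_mat B * B"
  have Bt: "transpose_mat B \<in> carrier_mat M N" using B by simp
  have G: "?G \<in> carrier_mat M M" using B by simp
  have "transpose_mat ?G = ?G"
    using transpose_mult[OF Bt B] by simp
  then obtain as where as: "char_poly ?G = (\<Prod>a\<leftarrow>as. [:- a, 1:])" "length as = M"
    using char_poly_symmetric_splits[OF G] by blast
  have "[:0, 1:] ^ M * char_poly (B * transpose_mat B) = [:0, 1:] ^ N * char_poly ?G"
    by (rule char_poly_mult_swap[OF B Bt])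
  \<comment> \<open>\<open>M \<le> N\<close> allows the power to be split so that the common factor
    \<open>[:0, 1:] ^ M\<close> cancels.\<close>
  also have "\<dots> = [:0, 1:] ^ M * ([:0, 1:] ^ (N - M) * char_poly ?G)"
    using \<open>M \<le> N\<close> by (simp flip: power_add mult.assoc)
  finally have "char_poly (B * transpose_mat B) = [:0, 1:] ^ (N - M) * char_poly ?G"
    by simp
  moreover have "char_poly ?G \<noteq> 0"
    unfolding as(1) by (auto simp: prod_list_zero_iff)
  ultimately have "proots (char_poly (B * transpose_mat B)) = replicate_mset (N - M) 0 + mset as"
    by (simp add: proots_mult proots_power as(1) proots_prod_linear_factors)
  moreover have "c \<le> a" if "a \<in> set as" for a
  proof -
    have "poly (char_poly ?G) a = 0"
      unfolding as(1) using that by (auto simp: poly_prod_list prod_list_zero_iff)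
    then obtain w where w: "w \<in> carrier_vec M" "w \<noteq> 0\<^sub>v M" "?G *\<^sub>v w = a \<cdot>\<^sub>v w"
      using eigenvalue_root_char_poly[OF G, of a] G unfolding eigenvalue_def eigenvector_def by auto
    have Bw: "B *\<^sub>v w \<in> carrier_vec N" using B w by simp
    have "a * (w \<bullet> w) = (?G *\<^sub>v w) \<bullet> w"
      using w by simp
    also have "?G *\<^sub>v w = transpose_mat B *\<^sub>v (B *\<^sub>v w)"
      using Bt B w by simp
    also have "\<dots> \<bullet> w = (B *\<^sub>v w) \<bullet> (B *\<^sub>v w)"
      by (rule transpose_vec_mult_scalar[OF B w(1) Bw])
    finally have "c * (w \<bullet> w) \<le> a * (w \<bullet> w)"
      using bound[OF w(1)] by simp
    moreover have "w \<bullet> w > 0"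
      using conjugate_square_greater_0_vec[OF w(1)] w by simp
    ultimately show ?thesis by simp
  qed
  moreover have "sum_list as = (\<Sum>j<M. \<Sum>i<N. (B $$ (i, j))\<^sup>2)"
    using sum_list_roots_char_poly[OF G as(1)] B
    by (auto simp: scalar_prod_def lessThan_atLeast0 power2_eq_square)
  ultimately show thesis using that as(2) by blast
qed

section \<open>Incidence matrices and pendent vertices\<close>

lemma enumeration_properties:
  assumes "finite A"
  shows "distinct (enumeration A)" "set (enumeration A) = A" "length (enumeration A) = card A"
proof -
  have "\<exists>xs. distinct xs \<and> set xs = A"
    using finite_distinct_list[OF assms] by blast
  from someI_ex[OF this] show "distinct (enumeration A)" "set (enumeration A) = A"
    by (auto simp: enumeration_def)
  then show "length (enumeration A) = card A"
    using distinct_card by metis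
qed

lemma bij_betw_enumeration:
  assumes "finite A"
  shows "bij_betw (\<lambda>i. enumeration A ! i) {..<card A} A"
  using bij_betw_nth[of "enumeration A" "{..<card A}" A] enumeration_properties[OF assms] by simp

text \<open>For an edge \<open>e\<close> these are its vertices of degree one. The energy results
  are stated for uniform hypergraphs whose edges all have at least \<open>t\<close> of them; the
  power hypergraph enters only afterwards.\<close>

definition pendent_vertices :: "'a hypergraph \<Rightarrow> 'a set \<Rightarrow> 'a set" where
  "pendent_vertices G e = {x \<in> hverts G \<inter> e. \<forall>f\<in>hedges G. x \<in> f \<longrightarrow> f = e}"

lemma uniform_hypergraph_finite:
  assumes "uniform_hypergraph q G"
  shows "finite (hverts G)" "finite (hedges G)"
  using assms finite_subset[of "hedges G" "Pow (hverts G)"]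
  by (auto simp: uniform_hypergraph_def)

text \<open>Entries are 0 or 1, so each column contributes the size of its edge. This evaluates the
  trace of the Gram matrix.\<close>

lemma sum_incidence_matrix_squares:
  assumes G: "uniform_hypergraph q G"
  shows "(\<Sum>j<card (hedges G). \<Sum>i<card (hverts G). (incidence_matrix G $$ (i, j))\<^sup>2) =
    real q * real (card (hedges G))"
proof -
  note fin = uniform_hypergraph_finite[OF G]
  let ?x = "\<lambda>i. enumeration (hverts G) ! i" and ?e = "\<lambda>j. enumeration (hedges G) ! j"
  have "(\<Sum>i<card (hverts G). (incidence_matrix G $$ (i, j))\<^sup>2) = real q"
    if j: "j < card (hedges G)" for j
  proof -
    have e: "?e j \<in> hedges G"
      using bij_betw_enumeration[OF fin(2)] j by (auto simp: bij_betw_def)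
    have "(\<Sum>i<card (hverts G). (incidence_matrix G $$ (i, j))\<^sup>2) =
        (\<Sum>i<card (hverts G). if ?x i \<in> ?e j then 1 else 0)"
      using j by (intro sum.cong) (auto simp: incidence_matrix_def)
    also have "\<dots> = (\<Sum>x\<in>hverts G. if x \<in> ?e j then 1 else 0)"
      by (rule sum.reindex_bij_betw[OF bij_betw_enumeration[OF fin(1)]])
    also have "\<dots> = real (card (hverts G \<inter> ?e j))"
      using fin(1) by (simp add: sum.If_cases Int_def)
    also have "hverts G \<inter> ?e j = ?e j"
      using G e by (auto simp: uniform_hypergraph_def)
    also have "card (?e j) = q"
      using G e by (auto simp: uniform_hypergraph_def)
    finally show ?thesis .
  qed
  then show ?thesis by simp
qed

text \<open>The row of a pendent vertex is a unit vector. Keeping only such rows leaves, for each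
  edge, at least \<open>t\<close> rows that reproduce its coordinate of \<open>w\<close>.\<close>

lemma incidence_matrix_bounded_below:
  assumes fin: "finite (hverts G)" "finite (hedges G)"
    and pendent: "\<And>e. e \<in> hedges G \<Longrightarrow> t \<le> card (pendent_vertices G e)"
    and w: "w \<in> carrier_vec (card (hedges G))"
  shows "real t * (w \<bullet> w) \<le> (incidence_matrix G *\<^sub>v w) \<bullet> (incidence_matrix G *\<^sub>v w)"
proof -
  define N M where "N = card (hverts G)" and "M = card (hedges G)"
  define x e where "x = (\<lambda>i. enumeration (hverts G) ! i)" and "e = (\<lambda>j. enumeration (hedges G) ! j)"
  let ?B = "incidence_matrix G"
  have bij_x: "bij_betw x {..<N} (hverts G)" and bij_e: "bij_betw e {..<M} (hedges G)"
    using bij_betw_enumeration fin by (simp_all add: x_def e_def N_def M_def)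
  \<comment> \<open>\<open>I j\<close> collects the rows of the pendent vertices of edge
    \<open>j\<close>.\<close>
  define I where "I = (\<lambda>j. {i \<in> {..<N}. x i \<in> pendent_vertices G (e j)})"
  have entry: "(?B *\<^sub>v w) $ i = w $ j" if j: "j < M" and i: "i \<in> I j" for i j
  proof -
    have i': "i < N" and xi: "x i \<in> pendent_vertices G (e j)" using i by (auto simp: I_def)
    have iff: "x i \<in> e l \<longleftrightarrow> l = j" if "l < M" for l
    proof -
      have "x i \<in> e l \<longleftrightarrow> e l = e j"
        using xi that bij_betw_apply[OF bij_e] by (auto simp: pendent_vertices_def)
      also have "\<dots> \<longleftrightarrow> l = j"
        using bij_e that j by (auto simp: bij_betw_def inj_on_def)
      finally show ?thesis .
    qed
    have "(?B *\<^sub>v w) $ i = (\<Sum>l<M. (if x i \<in> e l then 1 else 0) * w $ l)"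
      using w i' by (auto simp: incidence_matrix_def scalar_prod_def x_def e_def N_def M_def
          lessThan_atLeast0 intro!: sum.cong)
    also have "\<dots> = (\<Sum>l<M. if l = j then w $ l else 0)"
      by (rule sum.cong) (auto simp: iff)
    also have "\<dots> = w $ j" using j by simp
    finally show ?thesis .
  qed
  have card_I: "t \<le> card (I j)" if j: "j < M" for j
  proof -
    have "x ` I j = pendent_vertices G (e j)"
      using bij_x by (auto simp: I_def pendent_vertices_def bij_betw_def)
    then show ?thesis
      using pendent[OF bij_betw_apply[OF bij_e]] j card_image_le[of "I j" x] by (force simp: I_def)
  qed
  have disj: "I j \<inter> I l = {}" if "j < M" "l < M" "j \<noteq> l" for j l
  proof -
    have "e j \<noteq> e l" "e j \<in> hedges G" "e l \<in> hedges G"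
      using that bij_e bij_betw_apply[OF bij_e] by (auto simp: bij_betw_def inj_on_def)
    then show ?thesis by (auto simp: I_def pendent_vertices_def)
  qed
  have "real t * (w \<bullet> w) = (\<Sum>j<M. real t * (w $ j)\<^sup>2)"
    using w by (simp add: scalar_prod_def sum_distrib_left power2_eq_square M_def lessThan_atLeast0)
  also have "\<dots> \<le> (\<Sum>j<M. real (card (I j)) * (w $ j)\<^sup>2)"
    using card_I by (intro sum_mono mult_right_mono) auto
  also have "\<dots> = (\<Sum>j<M. \<Sum>i\<in>I j. ((?B *\<^sub>v w) $ i)\<^sup>2)"
    by (intro sum.cong) (auto simp: entry)
  also have "\<dots> = (\<Sum>i\<in>(\<Union>j<M. I j). ((?B *\<^sub>v w) $ i)\<^sup>2)"
    by (rule sum.UNION_disjoint[symmetric]) (use disj in \<open>auto simp: I_def\<close>)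
  \<comment> \<open>All remaining rows add nonnegative squares.\<close>
  also have "\<dots> \<le> (\<Sum>i<N. ((?B *\<^sub>v w) $ i)\<^sup>2)"
    by (rule sum_mono2) (auto simp: I_def)
  also have "\<dots> = (?B *\<^sub>v w) \<bullet> (?B *\<^sub>v w)"
    by (simp add: scalar_prod_def power2_eq_square N_def lessThan_atLeast0 incidence_matrix_def)
  finally show ?thesis .
qed

text \<open>A pendent vertex determines its edge, so choosing one in each edge is injective. This
  makes the number of additional zero eigenvalues a true difference.\<close>

lemma card_hedges_le_card_hverts:
  assumes fin: "finite (hverts G)" "finite (hedges G)"
    and pendent: "\<And>e. e \<in> hedges G \<Longrightarrow> pendent_vertices G e \<noteq> {}"
  shows "card (hedges G) \<le> card (hverts G)"
proof -
  define p where "p = (\<lambda>e. SOME x. x \<in> pendent_vertices G e)"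
  have p: "p e \<in> pendent_vertices G e" if "e \<in> hedges G" for e
    using pendent[OF that] by (simp add: p_def some_in_eq)
  have "inj_on p (hedges G)"
  proof (rule inj_onI)
    fix e f assume ef: "e \<in> hedges G" "f \<in> hedges G" "p e = p f"
    then have "p e \<in> f" using p[of f] by (simp add: pendent_vertices_def)
    then show "e = f" using p[of e] ef by (simp add: pendent_vertices_def)
  qed
  moreover have "p ` hedges G \<subseteq> hverts G"
    using p by (auto simp: pendent_vertices_def)
  ultimately show ?thesis using fin card_inj_on_le by blast
qed

section \<open>Energy of uniform hypergraphs with pendent vertices in every edge\<close>

lemma signless_laplacian_energy_eq_sum_list:
  assumes G: "uniform_hypergraph q G" and "0 < t"
    and pendent: "\<And>e. e \<in> hedges G \<Longrightarrow> t \<le> card (pendent_vertices G e)"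
  obtains as where "length as = card (hedges G)" "\<And>a. a \<in> set as \<Longrightarrow> real t \<le> a"
    "sum_list as = real q * real (card (hedges G))"
    "signless_laplacian_energy q G =
      (real (card (hverts G)) - real (card (hedges G))) * average_degree q G +
      (\<Sum>a\<leftarrow>as. \<bar>a - average_degree q G\<bar>)"
proof -
  note fin = uniform_hypergraph_finite[OF G]
  have le: "card (hedges G) \<le> card (hverts G)"
    by (rule card_hedges_le_card_hverts[OF fin]) (use pendent \<open>0 < t\<close> in fastforce)
  have B: "incidence_matrix G \<in> carrier_mat (card (hverts G)) (card (hedges G))"
    by (simp add: incidence_matrix_def)
  obtain as where as:
    "proots (char_poly (incidence_matrix G * transpose_mat (incidence_matrix G))) =
      replicate_mset (card (hverts G) - card (hedges G)) 0 + mset as"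
    "length as = card (hedges G)" "\<And>a. a \<in> set as \<Longrightarrow> real t \<le> a"
    "sum_list as =
      (\<Sum>j<card (hedges G). \<Sum>i<card (hverts G). (incidence_matrix G $$ (i, j))\<^sup>2)"
    using proots_char_poly_mult_transpose[OF B le incidence_matrix_bounded_below[OF fin pendent]]
    by blast
  \<comment> \<open>Nonnegativity makes each of the additional zero eigenvalues contribute exactly
    the average degree.\<close>
  have "average_degree q G \<ge> 0" by (simp add: average_degree_def)
  then have "signless_laplacian_energy q G =
      (real (card (hverts G)) - real (card (hedges G))) * average_degree q G +
      (\<Sum>a\<leftarrow>as. \<bar>a - average_degree q G\<bar>)"
    using le by (simp add: signless_laplacian_energy_def signless_laplacian_def as(1)
        sum_mset_sum_list of_nat_diff flip: mset_map)
  then show thesis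
    using that as sum_incidence_matrix_squares[OF G] by metis
qed

text \<open>Without vertices the left side is 0, and the pendent vertices then rule out edges;
  otherwise the division cancels.\<close>

lemma card_hverts_times_average_degree:
  assumes "uniform_hypergraph q G" "0 < t"
    and "\<And>e. e \<in> hedges G \<Longrightarrow> t \<le> card (pendent_vertices G e)"
  shows "real (card (hverts G)) * average_degree q G = real q * real (card (hedges G))"
proof (cases "card (hverts G) = 0")
  case True
  have "card (hedges G) \<le> card (hverts G)"
    by (rule card_hedges_le_card_hverts[OF uniform_hypergraph_finite[OF assms(1)]])
      (use assms in fastforce)
  then show ?thesis using True by simp
qed (simp add: average_degree_def)

text \<open>With \<open>d\<close> the average degree, every Gram eigenvalue is at least
  \<open>t \<ge> d\<close>, so the energy is \<open>(N - M) * d + (q * M - M * d)\<close>, and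
  \<open>N * d = q * M\<close>. Equality \<open>d = t\<close> is included, which covers the
  borderline case as well.\<close>

theorem signless_laplacian_energy_pendent_ge:
  assumes G: "uniform_hypergraph q G" and "0 < t"
    and pendent: "\<And>e. e \<in> hedges G \<Longrightarrow> t \<le> card (pendent_vertices G e)"
    and ge: "average_degree q G \<le> real t"
  shows "signless_laplacian_energy q G =
    2 * real (card (hedges G)) * (real q - average_degree q G)"
proof -
  define d where "d = average_degree q G"
  obtain as where as: "length as = card (hedges G)" "\<And>a. a \<in> set as \<Longrightarrow> real t \<le> a"
    "sum_list as = real q * real (card (hedges G))"
    "signless_laplacian_energy q G =
      (real (card (hverts G)) - real (card (hedges G))) * d + (\<Sum>a\<leftarrow>as. \<bar>a - d\<bar>)"
    using signless_laplacian_energy_eq_sum_list[OF assms(1-3)] unfolding d_def by metis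
  have "map (\<lambda>a. \<bar>a - d\<bar>) as = map (\<lambda>a. a - d) as"
    using as(2) ge by (force simp: d_def)
  then have "(\<Sum>a\<leftarrow>as. \<bar>a - d\<bar>) = (\<Sum>a\<leftarrow>as. a - d)" by metis
  also have "\<dots> = sum_list as - real (length as) * d"
    by (simp add: sum_list_subtractf sum_list_triv)
  finally show ?thesis
    using as card_hverts_times_average_degree[OF assms(1-3)] by (simp add: d_def algebra_simps)
qed

text \<open>The line \<open>a + (d - 2 * t)\<close> meets |a - d| at \<open>a = t\<close> and lies
  strictly above it for \<open>a > t\<close>, since \<open>t < d\<close>. Being linear with slope
  one, it sums up through the trace alone.\<close>

theorem signless_laplacian_energy_pendent_less:
  assumes G: "uniform_hypergraph q G" and "0 < t" "t < q"
    and pendent: "\<And>e. e \<in> hedges G \<Longrightarrow> t \<le> card (pendent_vertices G e)"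
    and less: "real t < average_degree q G"
  shows "signless_laplacian_energy q G < 2 * real (card (hedges G)) * (real q - real t)"
proof -
  define d where "d = average_degree q G"
  define M where "M = card (hedges G)"
  have Nd: "real (card (hverts G)) * d = real q * real M"
    using card_hverts_times_average_degree[OF assms(1,2,4)] by (simp add: d_def M_def)
  have td: "real t < d" using less by (simp add: d_def)
  \<comment> \<open>Without edges the average degree would be 0, against
    \<open>t < d\<close>.\<close>
  have "M > 0"
    using less by (cases "M = 0") (auto simp: M_def average_degree_def)
  obtain as where as: "length as = M" "\<And>a. a \<in> set as \<Longrightarrow> real t \<le> a"
    "sum_list as = real q * real M"
    "signless_laplacian_energy q G =
      (real (card (hverts G)) - real M) * d + (\<Sum>a\<leftarrow>as. \<bar>a - d\<bar>)"
    using signless_laplacian_energy_eq_sum_list[OF assms(1,2,4)] unfolding d_def M_def by metis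
  \<comment> \<open>The eigenvalues have mean \<open>q > t\<close>, so they cannot all equal
    \<open>t\<close>.\<close>
  have "\<exists>a\<in>set as. real t < a"
  proof (rule ccontr)
    assume "\<not> ?thesis"
    then have "sum_list as \<le> (\<Sum>a\<leftarrow>as. real t)"
      using sum_list_mono[of as "\<lambda>a. a" "\<lambda>_. real t"] by force
    then have "real q * real M \<le> real t * real M"
      using as by (simp add: sum_list_triv mult.commute)
    then show False using \<open>t < q\<close> \<open>M > 0\<close> by simp
  qed
  \<comment> \<open>List sums become sums over indices, where weak inequality throughout and one
    strict instance give strictness.\<close>
  then have "(\<Sum>a\<leftarrow>as. \<bar>a - d\<bar>) < (\<Sum>a\<leftarrow>as. a + (d - 2 * real t))"
    unfolding sum_list_sum_nth length_map
  proof (intro sum_strict_mono_ex1 ballI; (elim bexE)?)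
    fix i assume "i \<in> {0..<length as}"
    then show "map (\<lambda>a. \<bar>a - d\<bar>) as ! i \<le> map (\<lambda>a. a + (d - 2 * real t)) as ! i"
      using as(2)[of "as ! i"] td by auto
  next
    fix a assume "a \<in> set as" "real t < a"
    then obtain i where "i < length as" "real t < as ! i" by (auto simp: in_set_conv_nth)
    then show "\<exists>i\<in>{0..<length as}.
        map (\<lambda>a. \<bar>a - d\<bar>) as ! i < map (\<lambda>a. a + (d - 2 * real t)) as ! i"
      using td by (intro bexI[of _ i]) auto
  qed simp
  also have "\<dots> = real q * real M + real M * (d - 2 * real t)"
    using as by (simp add: sum_list_addf sum_list_triv)
  finally show ?thesis
    using as(4) Nd by (simp add: M_def[symmetric] algebra_simps)
qed

section \<open>Size, uniformity and pendent vertices of the power hypergraph\<close>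

lemma copy_mem_copies_iff:
  "VertexCopy v i \<in> vertex_copies s u \<longleftrightarrow> v = u \<and> i < s"
  "EdgeCopy e i \<in> edge_copies t f \<longleftrightarrow> e = f \<and> i < t"
  "VertexCopy v i \<notin> edge_copies t f"
  "EdgeCopy e i \<notin> vertex_copies s u"
  by (auto simp: vertex_copies_def edge_copies_def)

lemma card_copies: "card (vertex_copies s v) = s" "card (edge_copies t e) = t"
  by (auto simp: vertex_copies_def edge_copies_def card_image inj_on_def)

lemma finite_copies: "finite (vertex_copies s v)" "finite (edge_copies t e)"
  by (auto simp: vertex_copies_def edge_copies_def)

lemma card_UN_vertex_copies:
  assumes "finite A"
  shows "card (\<Union>v\<in>A. vertex_copies s v) = card A * s"
  using assms by (subst card_UN_disjoint) (simp_all add: card_copies finite_copies, auto simp: vertex_copies_def)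

lemma card_UN_edge_copies:
  assumes "finite E"
  shows "card (\<Union>e\<in>E. edge_copies t e) = card E * t"
  using assms by (subst card_UN_disjoint) (simp_all add: card_copies finite_copies, auto simp: edge_copies_def)

lemma card_edge_vertex_copies_Un:
  assumes "finite A" "finite E"
  shows "card ((\<Union>v\<in>A. vertex_copies s v) \<union> (\<Union>e\<in>E. edge_copies t e)) = card A * s + card E * t"
proof -
  have "(\<Union>v\<in>A. vertex_copies s v) \<inter> (\<Union>e\<in>E. edge_copies t e) = {}"
    by (auto simp: vertex_copies_def edge_copies_def)
  then show ?thesis
    using assms by (subst card_Un_disjoint)
      (auto simp: finite_copies card_UN_vertex_copies card_UN_edge_copies)
qed

context
  fixes H :: "'a hypergraph" and k r s :: nat
  assumes H: "uniform_hypergraph k H" and r: "k * s < r"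
begin

lemma card_hverts_power_hypergraph:
  "card (hverts (power_hypergraph k r s H)) =
    card (hverts H) * s + card (hedges H) * (r - k * s)"
  using card_edge_vertex_copies_Un[OF uniform_hypergraph_finite[OF H]]
  by (simp add: power_hypergraph_def)

text \<open>As \<open>k * s < r\<close>, the new edge of \<open>e\<close> contains
  \<open>EdgeCopy e 0\<close>, which identifies \<open>e\<close>.\<close>

lemma card_hedges_power_hypergraph:
  "card (hedges (power_hypergraph k r s H)) = card (hedges H)"
proof -
  have "inj_on (\<lambda>e. edge_copies (r - k * s) e \<union> (\<Union>v\<in>e. vertex_copies s v)) (hedges H)"
  proof (rule inj_onI)
    fix e f :: "'a set"
    assume "edge_copies (r - k * s) e \<union> (\<Union>v\<in>e. vertex_copies s v) =
      edge_copies (r - k * s) f \<union> (\<Union>v\<in>f. vertex_copies s v)"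
    moreover have "EdgeCopy e 0 \<in> edge_copies (r - k * s) e"
      using r by (simp add: copy_mem_copies_iff)
    ultimately have "EdgeCopy e 0 \<in> edge_copies (r - k * s) f \<union> (\<Union>v\<in>f. vertex_copies s v)"
      by blast
    then show "e = f" by (auto simp: copy_mem_copies_iff)
  qed
  then show ?thesis by (simp add: power_hypergraph_def card_image)
qed

lemma uniform_power_hypergraph: "uniform_hypergraph r (power_hypergraph k r s H)"
proof -
  have "card (edge_copies (r - k * s) e \<union> (\<Union>v\<in>e. vertex_copies s v)) = r"
    if "e \<in> hedges H" for e
  proof -
    have "finite e" "card e = k"
      using that H finite_subset by (auto simp: uniform_hypergraph_def)
    \<comment> \<open>A new edge is the union of copies over \<open>e\<close> and the singleton
      \<open>{e}\<close>, of size \<open>k * s + (r - k * s)\<close>.\<close>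
    then show ?thesis
      using card_edge_vertex_copies_Un[of e "{e}" s "r - k * s"] r by (simp add: Un_commute)
  qed
  moreover have "finite (hverts (power_hypergraph k r s H))"
    using uniform_hypergraph_finite[OF H] by (auto simp: power_hypergraph_def finite_copies)
  ultimately show ?thesis
    using H unfolding uniform_hypergraph_def power_hypergraph_def by fastforce
qed

text \<open>The added vertices carry \<open>e\<close> as a tag and therefore lie in no edge arising
  from a different one.\<close>

lemma card_pendent_vertices_power_hypergraph:
  assumes "e' \<in> hedges (power_hypergraph k r s H)"
  shows "r - k * s \<le> card (pendent_vertices (power_hypergraph k r s H) e')"
proof -
  from assms obtain e where e: "e \<in> hedges H"
    and e': "e' = edge_copies (r - k * s) e \<union> (\<Union>v\<in>e. vertex_copies s v)"
    by (auto simp: power_hypergraph_def)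
  have "edge_copies (r - k * s) e \<subseteq> pendent_vertices (power_hypergraph k r s H) e'"
    using e by (auto simp: e' pendent_vertices_def power_hypergraph_def edge_copies_def vertex_copies_def)
  moreover have "finite (pendent_vertices (power_hypergraph k r s H) e')"
    using uniform_hypergraph_finite[OF uniform_power_hypergraph] by (simp add: pendent_vertices_def)
  ultimately show ?thesis
    using card_mono card_copies(2) by metis
qed

end

section \<open>The three cases for the power hypergraph\<close>

text \<open>The strict inequality of the first case is guarded by \<open>m \<ge> 1\<close>: for
  \<open>m = 0\<close> the average degree is 0, so the case applies, but both sides vanish.\<close>

theorem theorem28:
  fixes H :: "'a hypergraph" and k n m s r :: nat
  assumes "k \<ge> 2"
    and "uniform_hypergraph k H"
    and "card (hverts H) = n"
    and "card (hedges H) = m"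
    and "s \<ge> 1"
    and "r > k * s"
  shows
    "(real r - real k * real s > average_degree r (power_hypergraph k r s H) \<longrightarrow>
        signless_laplacian_energy r (power_hypergraph k r s H) =
          2 * real r * real m *
            (1 - real m / (real n * real s + (real r - real k * real s) * real m)) \<and>
        (m \<ge> 1 \<longrightarrow>
          2 * real r * real m *
            (1 - real m / (real n * real s + (real r - real k * real s) * real m))
          > 2 * real k * real s * real m)) \<and>
     (real r - real k * real s = average_degree r (power_hypergraph k r s H) \<longrightarrow>
        signless_laplacian_energy r (power_hypergraph k r s H) = 2 * real k * real s * real m) \<and>
     (real r - real k * real s < average_degree r (power_hypergraph k r s H) \<longrightarrow>
        signless_laplacian_energy r (power_hypergraph k r s H) < 2 * real k * real s * real m)"
proof -
  let ?G = "power_hypergraph k r s H"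
  define t d where "t = r - k * s" and "d = average_degree r ?G"
  \<comment> \<open>\<open>t < r\<close> holds because \<open>k * s\<close> is positive; the strict
    bound of the third case rests on it.\<close>
  have t: "0 < t" "t < r" "real t = real r - real k * real s"
    using assms(1,5,6) by (auto simp: t_def of_nat_diff)
  note G = uniform_power_hypergraph[OF assms(2,6)]
  note pendent = card_pendent_vertices_power_hypergraph[OF assms(2,6), folded t_def]
  have M: "card (hedges ?G) = m"
    using card_hedges_power_hypergraph[OF assms(2,6)] assms(4) by simp
  have d: "d = real r * real m / (real n * real s + real t * real m)"
    using card_hverts_power_hypergraph[OF assms(2,6)] M assms(3,4)
    by (simp add: d_def average_degree_def mult.commute flip: t_def)
  have energy: "signless_laplacian_energy r ?G = 2 * real m * (real r - d)" if "d \<le> real t"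
    using signless_laplacian_energy_pendent_ge[OF G t(1) pendent] that M by (simp add: d_def)
  \<comment> \<open>The denominator is the number of vertices, so \<open>d\<close> absorbs the
    fraction. With \<open>ks\<close> below, the claims reduce to comparing \<open>d\<close> with
    \<open>t\<close>.\<close>
  have rhs: "2 * real r * real m * (1 - real m / (real n * real s + real t * real m)) =
      2 * real m * (real r - d)"
    by (simp add: d algebra_simps)
  have less: "signless_laplacian_energy r ?G < 2 * real m * (real r - real t)" if "real t < d"
    using signless_laplacian_energy_pendent_less[OF G t(1,2) pendent] that M by (simp add: d_def)
  have ks: "2 * real k * real s * real m = 2 * real m * (real r - real t)"
    by (simp add: t(3))
  show ?thesis
    unfolding t(3)[symmetric] d_def[symmetric] rhs ks using energy less by auto
qed

end
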